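(* Let $k_n, k_{n-1}, k_{n-2} > 0$ be successive (variable) time steps, with $k_j = t_{j+1}-t_j$, and consider the two-stage method for $y' = f(t,y)$ $$\tilde{y}_n = y_n - \frac{\alpha_n}{2}\left(\frac{2k_{n-2}}{k_{n-1}+k_{n-2}}\,y_n - 2y_{n-1} + \frac{2k_{n-1}}{k_{n-1}+k_{n-2}}\,y_{n-2}\right),$$ $$\frac{y_{n+1}-\tilde{y}_n}{k_n} = f(t_{n+1},y_{n+1}),$$ where $\alpha_n$ is a real coefficient. The value of $\alpha_n$ for which this method is second order is $$\alpha_n = \frac{k_n^2}{k_{n-1}k_{n-2}}.$$
   Context: The method computes $y_{n+1}\approx y(t_{n+1})$ from $y_n, y_{n-1}, y_{n-2}$ (approximations at $t_n = t_{n+1}-k_n$, $t_{n-1} = t_n - k_{n-1}$, $t_{n-2} = t_{n-1}-k_{n-2}$): first a pre-filter step producing $\tilde y_n$, then an Implicit Euler solve. Order: eliminating $\tilde y_n$ gives an equivalent linear multistep method. For a smooth function $y$, its residual is $$R[y] = y(t_{n+1}) - y(t_n) + \frac{\alpha_n}{2}\left(\frac{2k_{n-2}}{k_{n-1}+k_{n-2}}y(t_n) - 2y(t_{n-1}) + \frac{2k_{n-1}}{k_{n-1}+k_{n-2}}y(t_{n-2})\right) - k_n y'(t_{n+1}).$$ The method is second order if, in the Taylor expansion of $R[y]$ about $t_{n+1}$, the coefficients of $y(t_{n+1})$, $y'(t_{n+1})$ and $y''(t_{n+1})$ all vanish (so that only terms of third order and higher remain in the local truncation error). *)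

theory Defs
  imports "HOL-Analysis.Analysis"
begin

definition step :: "(nat \<Rightarrow> real) \<Rightarrow> nat \<Rightarrow> real" where
  "step t j = t (Suc j) - t j"

definition prefiltered :: "(nat \<Rightarrow> real) \<Rightarrow> real \<Rightarrow> nat \<Rightarrow> (nat \<Rightarrow> real) \<Rightarrow> real" where
  "prefiltered t \<alpha> n Y = Y n - \<alpha> / 2 *
     (2 * step t (n - 2) / (step t (n - 1) + step t (n - 2)) * Y n
      - 2 * Y (n - 1)
      + 2 * step t (n - 1) / (step t (n - 1) + step t (n - 2)) * Y (n - 2))"

definition two_stage_step ::
  "(real \<Rightarrow> real \<Rightarrow> real) \<Rightarrow> (nat \<Rightarrow> real) \<Rightarrow> real \<Rightarrow> nat \<Rightarrow> (nat \<Rightarrow> real) \<Rightarrow> bool" where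
  "two_stage_step f t \<alpha> n Y \<longleftrightarrow>
     (Y (Suc n) - prefiltered t \<alpha> n Y) / step t n = f (t (Suc n)) (Y (Suc n))"

(* Defect of the equivalent linear multistep method; F stands for f(t_{n+1}, y_{n+1}). *)
definition multistep_defect ::
  "(nat \<Rightarrow> real) \<Rightarrow> real \<Rightarrow> nat \<Rightarrow> (nat \<Rightarrow> real) \<Rightarrow> real \<Rightarrow> real" where
  "multistep_defect t \<alpha> n Y F = Y (Suc n) - prefiltered t \<alpha> n Y - step t n * F"

lemma two_stage_step_iff_multistep:
  assumes "step t n > 0"
  shows "two_stage_step f t \<alpha> n Y \<longleftrightarrow>
         multistep_defect t \<alpha> n Y (f (t (Suc n)) (Y (Suc n))) = 0"
  using assms by (auto simp: two_stage_step_def multistep_defect_def field_simps)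

definition residual :: "(nat \<Rightarrow> real) \<Rightarrow> real \<Rightarrow> nat \<Rightarrow> (real \<Rightarrow> real) \<Rightarrow> real" where
  "residual t \<alpha> n y = multistep_defect t \<alpha> n (\<lambda>j. y (t j)) (deriv y (t (Suc n)))"

lemma residual_eq:
  "residual t \<alpha> n y = y (t (Suc n)) - y (t n) + \<alpha> / 2 *
     (2 * step t (n - 2) / (step t (n - 1) + step t (n - 2)) * y (t n)
      - 2 * y (t (n - 1))
      + 2 * step t (n - 1) / (step t (n - 1) + step t (n - 2)) * y (t (n - 2)))
     - step t n * deriv y (t (Suc n))"
  by (simp add: residual_def multistep_defect_def prefiltered_def)

definition smooth :: "(real \<Rightarrow> real) \<Rightarrow> bool" where
  "smooth y \<longleftrightarrow> (\<forall>j x. (deriv ^^ j) y differentiable (at x))"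

(* The formal Taylor expansion of the residual about t_{n+1} is the sum of
   c j * y^(j)(t_{n+1}) over j, with c independent of y.  This is read as: for every m,
   the partial sum up to m approximates the residual of every smooth y up to a Taylor
   remainder, i.e. a constant (independent of y) times a bound for y^(m+1) on the nodes'
   interval.  Testing with polynomials of degree at most m (bound 0) shows that c is unique. *)
definition residual_taylor_coeffs ::
  "(nat \<Rightarrow> real) \<Rightarrow> real \<Rightarrow> nat \<Rightarrow> (nat \<Rightarrow> real) \<Rightarrow> bool" where
  "residual_taylor_coeffs t \<alpha> n c \<longleftrightarrow>
     (\<forall>m. \<exists>C. \<forall>y M. smooth y \<longrightarrow>
        (\<forall>s\<in>{t (n - 2)..t (Suc n)}. \<bar>(deriv ^^ Suc m) y s\<bar> \<le> M) \<longrightarrow>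
        \<bar>residual t \<alpha> n y - (\<Sum>j\<le>m. c j * (deriv ^^ j) y (t (Suc n)))\<bar> \<le> C * M)"

definition second_order :: "(nat \<Rightarrow> real) \<Rightarrow> real \<Rightarrow> nat \<Rightarrow> bool" where
  "second_order t \<alpha> n \<longleftrightarrow>
     (\<exists>c. residual_taylor_coeffs t \<alpha> n c \<and> c 0 = 0 \<and> c 1 = 0 \<and> c 2 = 0)"

end

theory Submission
  imports Defs
begin

text \<open>
  Taylor's theorem at \<open>t (Suc n)\<close> applied to each node value gives the coefficients of the residual.
  Those of order 0 and 1 vanish for every \<open>\<alpha>\<close>, while the one of order 2 is
  \<open>(\<alpha> * (step t (n - 1) * step t (n - 2)) - (step t n)\<^sup>2) / 2\<close>. Conversely, whatever the coefficients are,
  the quadratic \<open>\<lambda>x. (x - t (Suc n))\<^sup>2\<close> has no Taylor remainder for \<open>m = 2\<close>, so its residual is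
  twice the coefficient of order 2.
\<close>

lemma smooth_has_deriv:
  assumes "smooth y"
  shows "((deriv ^^ j) y has_real_derivative (deriv ^^ Suc j) y x) (at x)"
  using assms
  by (simp add: smooth_def DERIV_deriv_iff_real_differentiable)

text \<open>Lagrange remainder of an expansion at \<open>T\<close>. Only points
  \<open>x \<le> T\<close> are considered, since every node of the method lies at or before
  \<open>t (Suc n)\<close>.\<close>

lemma smooth_taylor_bound:
  assumes y: "smooth y" and "x \<le> T"
    and M: "\<And>s. x \<le> s \<Longrightarrow> s \<le> T \<Longrightarrow> \<bar>(deriv ^^ Suc m) y s\<bar> \<le> M"
  shows "\<bar>y x - (\<Sum>j\<le>m. (x - T) ^ j / fact j * (deriv ^^ j) y T)\<bar>
           \<le> \<bar>x - T\<bar> ^ Suc m / fact (Suc m) * M"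
\<comment> \<open>\<open>Taylor\<close> requires the point of evaluation to differ from the centre;
  for \<open>x = T\<close> both sides are 0.\<close>
proof (cases "x = T")
  case True
  have "(\<Sum>j\<le>m. (x - T) ^ j / fact j * (deriv ^^ j) y T) = y T"
    using True by (simp add: sum.atMost_shift)
  then show ?thesis using True by simp
next
  case False
  then have "x < T" using \<open>x \<le> T\<close> by simp
  obtain s where s: "x < s" "s < T"
    and eq: "y x = (\<Sum>j<Suc m. (deriv ^^ j) y T / fact j * (x - T) ^ j)
                  + (deriv ^^ Suc m) y s / fact (Suc m) * (x - T) ^ Suc m"
    using Taylor[of "Suc m" "\<lambda>j. (deriv ^^ j) y" y x T T x] smooth_has_deriv[OF y] \<open>x < T\<close>
    by (auto simp del: fact_Suc power_Suc)
  have "(\<Sum>j<Suc m. (deriv ^^ j) y T / fact j * (x - T) ^ j)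
          = (\<Sum>j\<le>m. (x - T) ^ j / fact j * (deriv ^^ j) y T)"
    by (intro sum.cong) (auto simp: lessThan_Suc_atMost)
  then have "\<bar>y x - (\<Sum>j\<le>m. (x - T) ^ j / fact j * (deriv ^^ j) y T)\<bar>
      = \<bar>x - T\<bar> ^ Suc m / fact (Suc m) * \<bar>(deriv ^^ Suc m) y s\<bar>"
    using eq by (simp add: abs_mult power_abs del: fact_Suc power_Suc)
  also have "\<dots> \<le> \<bar>x - T\<bar> ^ Suc m / fact (Suc m) * M"
    using M s by (intro mult_left_mono) auto
  finally show ?thesis .
qed

text \<open>The residual of the monomial \<open>p\<close>, whose derivative at
  \<open>t (Suc n)\<close> is 1 for \<open>j = 1\<close> and 0 otherwise. By linearity of the
  residual this is the factor that multiplies the \<open>j\<close>-th derivative in the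
  expansion.\<close>

definition residual_coeff :: "(nat \<Rightarrow> real) \<Rightarrow> real \<Rightarrow> nat \<Rightarrow> nat \<Rightarrow> real" where
  "residual_coeff t \<alpha> n j =
     (let p = (\<lambda>x. (x - t (Suc n)) ^ j / fact j) in
      p (t (Suc n)) - p (t n) + \<alpha> / 2 *
        (2 * step t (n - 2) / (step t (n - 1) + step t (n - 2)) * p (t n)
         - 2 * p (t (n - 1))
         + 2 * step t (n - 1) / (step t (n - 1) + step t (n - 2)) * p (t (n - 2)))
      - (if j = 1 then step t n else 0))"

text \<open>The residual is a fixed linear combination of node values and one derivative, so its
  remainder is the same combination of Taylor remainders. The triangle inequality then gives a
  constant that depends on \<open>m\<close>, \<open>\<alpha>\<close> and the nodes but not on
  \<open>y\<close>.\<close>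

lemma residual_taylor_coeffs_residual_coeff:
  assumes le: "t (n - 2) \<le> t (n - 1)" "t (n - 1) \<le> t n" "t n \<le> t (Suc n)"
  shows "residual_taylor_coeffs t \<alpha> n (residual_coeff t \<alpha> n)"
  unfolding residual_taylor_coeffs_def
proof (intro allI exI impI)
  fix m y M
  assume y: "smooth y"
    and M: "\<forall>s\<in>{t (n - 2)..t (Suc n)}. \<bar>(deriv ^^ Suc m) y s\<bar> \<le> M"
  define T where "T = t (Suc n)"
  define u where "u = \<alpha> / 2 * (2 * step t (n - 2) / (step t (n - 1) + step t (n - 2)))"
  define v where "v = \<alpha> / 2 * (2 * step t (n - 1) / (step t (n - 1) + step t (n - 2)))"
  \<comment> \<open>\<open>e x\<close> is the remainder at \<open>x\<close>, with bound
    \<open>B x * M\<close>; \<open>d\<close> is the remainder of the term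
    \<open>deriv y T\<close>.\<close>
  define e where "e x = y x - (\<Sum>j\<le>m. (x - T) ^ j / fact j * (deriv ^^ j) y T)" for x
  define B where "B x = \<bar>x - T\<bar> ^ Suc m / fact (Suc m)" for x
  define d where "d = deriv y T - (\<Sum>j\<le>m. (if j = 1 then 1 else 0) * (deriv ^^ j) y T)"
  have res: "residual t \<alpha> n y
      = y T - y (t n) + u * y (t n) - \<alpha> * y (t (n - 1)) + v * y (t (n - 2)) - step t n * deriv y T"
    unfolding residual_eq T_def u_def v_def by (simp add: algebra_simps)
  have coeff: "residual_coeff t \<alpha> n j =
      (T - T) ^ j / fact j - (t n - T) ^ j / fact j + u * ((t n - T) ^ j / fact j)
      - \<alpha> * ((t (n - 1) - T) ^ j / fact j) + v * ((t (n - 2) - T) ^ j / fact j)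
      - step t n * (if j = 1 then 1 else 0)" for j
    unfolding residual_coeff_def T_def u_def v_def Let_def by (simp add: algebra_simps)
  define S where "S x = (\<Sum>j\<le>m. (x - T) ^ j / fact j * (deriv ^^ j) y T)" for x
  define S' where "S' = (\<Sum>j\<le>m. (if j = 1 then 1 else 0) * (deriv ^^ j) y T)"
  have "(\<Sum>j\<le>m. residual_coeff t \<alpha> n j * (deriv ^^ j) y T)
      = S T - S (t n) + u * S (t n) - \<alpha> * S (t (n - 1)) + v * S (t (n - 2)) - step t n * S'"
    unfolding S_def S'_def coeff sum_distrib_left sum_subtractf[symmetric] sum.distrib[symmetric]
    by (intro sum.cong refl) (simp only: left_diff_distrib distrib_right mult.assoc)
  then have expand: "residual t \<alpha> n y - (\<Sum>j\<le>m. residual_coeff t \<alpha> n j * (deriv ^^ j) y T)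
      = e T - e (t n) + u * e (t n) - \<alpha> * e (t (n - 1)) + v * e (t (n - 2)) - step t n * d"
    unfolding res e_def d_def S_def[symmetric] S'_def[symmetric] by (simp add: algebra_simps)
  have e: "\<bar>e x\<bar> \<le> B x * M" if "t (n - 2) \<le> x" "x \<le> T" for x
    unfolding e_def B_def
    using M that by (intro smooth_taylor_bound[OF y]) (auto simp: T_def)
  have eT: "e T = 0"
    using e[of T] le by (simp add: B_def T_def)
  have n: "\<bar>e (t n)\<bar> \<le> B (t n) * M" "\<bar>e (t (n - 1))\<bar> \<le> B (t (n - 1)) * M"
      "\<bar>e (t (n - 2))\<bar> \<le> B (t (n - 2)) * M"
    using le by (auto intro!: e simp: T_def)
  \<comment> \<open>For \<open>m = 0\<close> this bounds \<open>d = deriv y T\<close> itself; for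
    \<open>m > 0\<close> it supplies \<open>0 \<le> M\<close>.\<close>
  have MT: "\<bar>(deriv ^^ Suc m) y T\<bar> \<le> M"
    using M le by (auto simp: T_def)
  \<comment> \<open>The derivative term has a remainder only for \<open>m = 0\<close>.\<close>
  have d: "\<bar>d\<bar> \<le> M"
  proof (cases m)
    case 0
    then show ?thesis using MT by (simp add: d_def)
  next
    case (Suc k)
    then have "d = 0" by (simp add: d_def if_distrib[of "\<lambda>a. a * _"] sum.delta cong: if_cong)
    then show ?thesis using MT by simp
  qed
  have "\<bar>- e (t n) + u * e (t n) - \<alpha> * e (t (n - 1)) + v * e (t (n - 2)) - step t n * d\<bar>
      \<le> \<bar>e (t n)\<bar> + \<bar>u\<bar> * \<bar>e (t n)\<bar> + \<bar>\<alpha>\<bar> * \<bar>e (t (n - 1))\<bar> + \<bar>v\<bar> * \<bar>e (t (n - 2))\<bar> + \<bar>step t n\<bar> * \<bar>d\<bar>"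
    unfolding abs_mult[symmetric] by linarith
  also have "\<dots> \<le> B (t n) * M + \<bar>u\<bar> * (B (t n) * M) + \<bar>\<alpha>\<bar> * (B (t (n - 1)) * M)
      + \<bar>v\<bar> * (B (t (n - 2)) * M) + \<bar>step t n\<bar> * M"
    by (intro add_mono mult_left_mono n d) auto
  also have "\<dots> = (B (t n) + \<bar>u\<bar> * B (t n) + \<bar>\<alpha>\<bar> * B (t (n - 1)) + \<bar>v\<bar> * B (t (n - 2)) + \<bar>step t n\<bar>) * M"
    by (simp add: algebra_simps)
  finally show "\<bar>residual t \<alpha> n y - (\<Sum>j\<le>m. residual_coeff t \<alpha> n j * (deriv ^^ j) y (t (Suc n)))\<bar>
      \<le> (B (t n) + \<bar>u\<bar> * B (t n) + \<bar>\<alpha>\<bar> * B (t (n - 1)) + \<bar>v\<bar> * B (t (n - 2)) + \<bar>step t n\<bar>) * M"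
    using expand eT by (simp add: T_def)
qed

lemma deriv_funpow_zero: "(deriv ^^ j) (\<lambda>x::real. 0::real) = (\<lambda>x. 0)"
  by (induction j) auto

text \<open>Data of the test function: the first derivative enters its residual, and the vanishing
  third one makes \<open>M = 0\<close> an admissible bound at \<open>m = 2\<close>.\<close>

lemma higher_deriv_square:
  fixes T :: real
  defines "q \<equiv> \<lambda>x. (x - T)\<^sup>2"
  shows "deriv q = (\<lambda>x. 2 * (x - T))" "(deriv ^^ 2) q = (\<lambda>x. 2)" "(deriv ^^ (3 + j)) q = (\<lambda>x. 0)"
proof -
  show 1: "deriv q = (\<lambda>x. 2 * (x - T))"
    unfolding q_def by (intro ext DERIV_imp_deriv) (auto intro!: derivative_eq_intros)
  have "deriv (\<lambda>x. 2 * (x - T)) = (\<lambda>x. 2)"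
    by (intro ext DERIV_imp_deriv) (auto intro!: derivative_eq_intros)
  then show 2: "(deriv ^^ 2) q = (\<lambda>x. 2)"
    by (simp add: numeral_2_eq_2 1)
  have "(deriv ^^ 3) q = (\<lambda>x. 0)"
    using 2 by (simp add: numeral_3_eq_3 numeral_2_eq_2)
  then show "(deriv ^^ (3 + j)) q = (\<lambda>x. 0)"
    by (simp only: add.commute[of 3] funpow_add o_apply deriv_funpow_zero)
qed

lemma smooth_square: "smooth (\<lambda>x. (x - T)\<^sup>2)"
  unfolding smooth_def
proof (intro allI)
  fix j :: nat and x
  consider "j = 0" | "j = 1" | "j = 2" | k where "j = 3 + k"
  proof -
    assume *: "j = 0 \<Longrightarrow> thesis" "j = 1 \<Longrightarrow> thesis" "j = 2 \<Longrightarrow> thesis" "\<And>k. j = 3 + k \<Longrightarrow> thesis"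
    have "j = 0 \<or> j = 1 \<or> j = 2 \<or> j = 3 + (j - 3)" by arith
    then show thesis using * by blast
  qed
  then show "(deriv ^^ j) (\<lambda>x. (x - T)\<^sup>2) differentiable at x"
    by cases (simp_all add: higher_deriv_square)
qed

text \<open>The bracket is \<open>2 * b * d\<close> times the second divided difference over the
  three oldest nodes, which equals 1 for a monic quadratic. Here \<open>a\<close>,
  \<open>a + b\<close> and \<open>a + b + d\<close> are the distances of these nodes from
  \<open>t (Suc n)\<close>.\<close>

lemma quadratic_defect:
  fixes a b d \<alpha> :: real
  assumes "b + d \<noteq> 0"
  shows "- a\<^sup>2 + \<alpha> / 2 * (2 * d / (b + d) * a\<^sup>2 - 2 * (a + b)\<^sup>2 + 2 * b / (b + d) * (a + b + d)\<^sup>2)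
           = \<alpha> * (b * d) - a\<^sup>2"
  using assms by (simp add: divide_simps) (simp add: algebra_simps power2_eq_square)

theorem proposition1:
  fixes t :: "nat \<Rightarrow> real" and \<alpha> :: real and n :: nat
  assumes "n \<ge> 2"
    and "step t n > 0" and "step t (n - 1) > 0" and "step t (n - 2) > 0"
  shows "second_order t \<alpha> n \<longleftrightarrow> \<alpha> = (step t n)\<^sup>2 / (step t (n - 1) * step t (n - 2))"
proof -
  define a b d where "a = step t n" and "b = step t (n - 1)" and "d = step t (n - 2)"
  have pos: "a > 0" "b > 0" "d > 0"
    using assms by (auto simp: a_def b_def d_def)
  \<comment> \<open>For \<open>n \<ge> 2\<close> the subtractions do not truncate, so the steps
    telescope to the node distances.\<close>
  have idx: "Suc (n - 1) = n" "Suc (n - 2) = n - 1"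
    using \<open>n \<ge> 2\<close> by auto
  have nodes: "t n - t (Suc n) = - a" "t (n - 1) - t (Suc n) = - (a + b)"
      "t (n - 2) - t (Suc n) = - (a + b + d)"
    unfolding a_def b_def d_def step_def idx by simp_all
  have le: "t (n - 2) \<le> t (n - 1)" "t (n - 1) \<le> t n" "t n \<le> t (Suc n)"
    using nodes pos by linarith+
  have sq: "(\<alpha> = a\<^sup>2 / (b * d)) \<longleftrightarrow> \<alpha> * (b * d) - a\<^sup>2 = 0"
    using pos by (auto simp: field_simps)
  have bd: "b + d \<noteq> 0" using pos by simp
  have "second_order t \<alpha> n \<longleftrightarrow> \<alpha> * (b * d) - a\<^sup>2 = 0"
  proof
    assume "second_order t \<alpha> n"
    then obtain c where c: "residual_taylor_coeffs t \<alpha> n c" "c 0 = 0" "c 1 = 0" "c 2 = 0"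
      by (auto simp: second_order_def)
    define q where "q = (\<lambda>x. (x - t (Suc n))\<^sup>2)"
    obtain C where C: "\<And>y M. smooth y \<Longrightarrow>
        (\<forall>s\<in>{t (n - 2)..t (Suc n)}. \<bar>(deriv ^^ Suc 2) y s\<bar> \<le> M) \<Longrightarrow>
        \<bar>residual t \<alpha> n y - (\<Sum>j\<le>2. c j * (deriv ^^ j) y (t (Suc n)))\<bar> \<le> C * M"
      using c(1) unfolding residual_taylor_coeffs_def by blast
    have "(deriv ^^ Suc 2) q = (\<lambda>x. 0)"
      using higher_deriv_square(3)[of 0] by (simp add: q_def numeral_3_eq_3 numeral_2_eq_2)
    moreover have "(\<Sum>j\<le>2. c j * (deriv ^^ j) q (t (Suc n))) = 0"
      using c by (simp add: numeral_2_eq_2)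
    \<comment> \<open>With \<open>M = 0\<close> the bound \<open>C * M\<close> is 0 whatever
      \<open>C\<close> is, so the estimate becomes an equality.\<close>
    ultimately have "residual t \<alpha> n q = 0"
      using C[of q 0] smooth_square by (simp add: q_def)
    \<comment> \<open>\<open>deriv q\<close> vanishes at \<open>t (Suc n)\<close>, so only node
      values remain, and squaring removes the signs of the offsets.\<close>
    then show "\<alpha> * (b * d) - a\<^sup>2 = 0"
      using quadratic_defect[OF bd, of a \<alpha>]
      unfolding residual_eq q_def higher_deriv_square(1) nodes power2_minus
      by (simp add: a_def b_def d_def)
  next
    assume 0: "\<alpha> * (b * d) - a\<^sup>2 = 0"
    let ?c = "residual_coeff t \<alpha> n"
    note c = residual_coeff_def Let_def nodes a_def[symmetric] b_def[symmetric] d_def[symmetric]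
    \<comment> \<open>A second divided difference annihilates polynomials of degree at most 1, and
      Implicit Euler is exact on them.\<close>
    have "?c 0 = 0" "?c 1 = 0"
      unfolding c using bd by (simp_all add: divide_simps) (simp_all add: algebra_simps)
    \<comment> \<open>The factor 1/2 is the \<open>fact 2\<close> in the normalised
      monomial.\<close>
    moreover have "?c 2 = (\<alpha> * (b * d) - a\<^sup>2) / 2"
      unfolding c power2_minus quadratic_defect[OF bd, of a \<alpha>, symmetric]
      using bd by (simp add: divide_simps) (simp add: algebra_simps)
    ultimately show "second_order t \<alpha> n"
      unfolding second_order_def
      using 0 residual_taylor_coeffs_residual_coeff[OF le, of \<alpha>] by auto
  qed
  then show ?thesis
    using sq by (simp add: a_def b_def d_def)
qed

end
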